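(* Let $(H;\langle\cdot,\cdot\rangle)$ be an inner product space over $\mathbb{K}$, let $x,y\in H$ and $\gamma,\Gamma\in\mathbb{K}$ with $\Gamma\neq\gamma$ and $\Gamma\ne-\gamma$, such that either $$\operatorname{Re}\langle \Gamma y-x,\,x-\gamma y\rangle\ge 0,$$ or, equivalently, $$\left\|x-\frac{\gamma+\Gamma}{2}y\right\|\le \frac12|\Gamma-\gamma|\,\|y\|$$ holds. Then $$0\le \|x\|\|y\|-|\langle x,y\rangle| \le \|x\|\|y\|-\left|\operatorname{Re}\left[\frac{\bar\Gamma+\bar\gamma}{|\Gamma+\gamma|}\langle x,y\rangle\right]\right| \le \|x\|\|y\|-\operatorname{Re}\left[\frac{\bar\Gamma+\bar\gamma}{|\Gamma+\gamma|}\langle x,y\rangle\right] \le \frac14\cdot\frac{|\Gamma-\gamma|^2}{|\Gamma+\gamma|}\|y\|^2 .$$ The constant $\frac14$ in the last inequality is best possible: there is no $c<\frac14$ such that the last inequality holds with $c$ in place of $\frac14$ for all inner product spaces $H$ over $\mathbb{K}$ and all $x,y\in H$, $\gamma,\Gamma\in\mathbb{K}$ with $\Gamma\neq\gamma$, $\Gamma\neq-\gamma$ and $\operatorname{Re}\langle \Gamma y-x,\,x-\gamma y\rangle\ge 0$.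
   Context: $\mathbb{K}$ denotes $\mathbb{R}$ or $\mathbb{C}$. Inner products are linear in the first argument and conjugate-linear in the second, and $\|x\|=\langle x,x\rangle^{1/2}$. *)

theory Defs
  imports Complex_Main "HOL-Algebra.Module"
begin

text \<open>
  The scalar field is a set \<open>K\<close> of complex numbers, namely either \<open>\<real>\<close> (the real numbers inside
  \<open>complex\<close>) or \<open>UNIV\<close>.  This way \<open>cnj\<close>, \<open>Re\<close> and \<open>cmod\<close> serve both cases; on \<open>\<real>\<close> they are the
  identity, the embedding's inverse and the absolute value.
\<close>

definition scalar_field :: "complex set \<Rightarrow> complex ring" where
  "scalar_field K = \<lparr>carrier = K, monoid.mult = (*), one = 1, ring.zero = 0, add = (+)\<rparr>"

text \<open>
  The ring multiplication and unit that the record type \<open>module\<close> provides on vectors are not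
  constrained by the locale \<open>module\<close> and play no role.
\<close>

locale inner_product_space = module "scalar_field K" H
  for K :: "complex set" and H :: "(complex, 'v) module" (structure) +
  fixes ip :: "'v \<Rightarrow> 'v \<Rightarrow> complex"
  assumes scalars: "K = \<real> \<or> K = UNIV"
    and ip_closed: "\<lbrakk>x \<in> carrier H; y \<in> carrier H\<rbrakk> \<Longrightarrow> ip x y \<in> K"
    and ip_add_left: "\<lbrakk>x \<in> carrier H; y \<in> carrier H; z \<in> carrier H\<rbrakk>
      \<Longrightarrow> ip (x \<oplus>\<^bsub>H\<^esub> y) z = ip x z + ip y z"
    and ip_smult_left: "\<lbrakk>a \<in> K; x \<in> carrier H; y \<in> carrier H\<rbrakk>
      \<Longrightarrow> ip (a \<odot>\<^bsub>H\<^esub> x) y = a * ip x y"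
    and ip_commute: "\<lbrakk>x \<in> carrier H; y \<in> carrier H\<rbrakk> \<Longrightarrow> ip y x = cnj (ip x y)"
    and ip_self_nonneg: "x \<in> carrier H \<Longrightarrow> 0 \<le> Re (ip x x)"
    and ip_self_eq_0: "\<lbrakk>x \<in> carrier H; ip x x = 0\<rbrakk> \<Longrightarrow> x = \<zero>\<^bsub>H\<^esub>"

text \<open>
  By \<open>ip_commute\<close>, \<open>ip x x\<close> is real, so \<open>Re\<close> loses nothing here.
\<close>

definition ip_norm :: "('v \<Rightarrow> 'v \<Rightarrow> complex) \<Rightarrow> 'v \<Rightarrow> real" where
  "ip_norm ip x = sqrt (Re (ip x x))"

end

theory Submission
  imports Defs
begin

text \<open>
  Both hypotheses rearrange to
  \<open>\<parallel>x\<parallel>\<^sup>2 + \<bar>\<Gamma> + \<gamma>\<bar>\<^sup>2/4 \<cdot> \<parallel>y\<parallel>\<^sup>2 \<le> Re ((cnj \<Gamma> + cnj \<gamma>) \<langle>x, y\<rangle>) + \<bar>\<Gamma> - \<gamma>\<bar>\<^sup>2/4 \<cdot> \<parallel>y\<parallel>\<^sup>2\<close>,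
  and AM-GM bounds the left-hand side below by \<open>\<bar>\<Gamma> + \<gamma>\<bar> \<parallel>x\<parallel> \<parallel>y\<parallel>\<close>; dividing by \<open>\<bar>\<Gamma> + \<gamma>\<bar>\<close> gives
  the last inequality.  Equality occurs when both the hypothesis and AM-GM are equalities, which
  already happens in the plane for \<open>y = 1\<close>, \<open>\<Gamma> + \<gamma> = 2\<close> and \<open>x\<close> on the unit circle at distance
  \<open>\<bar>\<Gamma> - \<gamma>\<bar>/2\<close> from \<open>1\<close>.
\<close>

section \<open>Inner product calculus and the Cauchy-Schwarz inequality\<close>

context inner_product_space
begin

lemma scalar_field_carrier [simp]: "carrier (scalar_field K) = K"
  by (simp add: scalar_field_def)

lemma smult_mem: "a \<in> K \<Longrightarrow> x \<in> carrier H \<Longrightarrow> a \<odot>\<^bsub>H\<^esub> x \<in> carrier H"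
  using smult_closed[of a x] by simp

lemma ip_zero_left: "z \<in> carrier H \<Longrightarrow> ip \<zero>\<^bsub>H\<^esub> z = 0"
  using ip_add_left[of "\<zero>\<^bsub>H\<^esub>" "\<zero>\<^bsub>H\<^esub>" z] by simp

lemma ip_minus_left:
  assumes "x \<in> carrier H" "y \<in> carrier H" "z \<in> carrier H"
  shows "ip (x \<ominus>\<^bsub>H\<^esub> y) z = ip x z - ip y z"
proof -
  have "ip (\<ominus>\<^bsub>H\<^esub> y) z = - ip y z"
    using ip_add_left[of y "\<ominus>\<^bsub>H\<^esub> y" z] assms
    by (simp add: M.r_neg ip_zero_left add_eq_0_iff)
  then show ?thesis
    using assms by (simp add: M.minus_eq ip_add_left)
qed

lemma ip_minus_right:
  assumes "x \<in> carrier H" "y \<in> carrier H" "z \<in> carrier H"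
  shows "ip z (x \<ominus>\<^bsub>H\<^esub> y) = ip z x - ip z y"
  using assms ip_commute[of "x \<ominus>\<^bsub>H\<^esub> y" z] ip_commute[of x z] ip_commute[of y z]
  by (simp add: ip_minus_left)

lemma ip_smult_right:
  assumes "a \<in> K" "x \<in> carrier H" "y \<in> carrier H"
  shows "ip x (a \<odot>\<^bsub>H\<^esub> y) = cnj a * ip x y"
  using assms ip_commute[of "a \<odot>\<^bsub>H\<^esub> y" x] ip_commute[of y x]
  by (simp add: ip_smult_left smult_mem)

lemma ip_self: "x \<in> carrier H \<Longrightarrow> ip x x = complex_of_real (Re (ip x x))"
  using ip_commute[of x x] by (auto simp: complex_eq_iff)

lemma ip_norm_sq: "x \<in> carrier H \<Longrightarrow> (ip_norm ip x)\<^sup>2 = Re (ip x x)"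
  by (simp add: ip_norm_def ip_self_nonneg)

lemma ip_norm_nonneg: "x \<in> carrier H \<Longrightarrow> 0 \<le> ip_norm ip x"
  by (simp add: ip_norm_def ip_self_nonneg)

text \<open>Used with \<open>a\<close> the projection coefficient for Cauchy-Schwarz, and with
  \<open>a\<close> the midpoint \<open>(\<gamma> + \<Gamma>) / 2\<close> for the norm form of the
  hypothesis.\<close>

lemma ip_norm_sq_diff_smult:
  assumes "a \<in> K" and x: "x \<in> carrier H" and y: "y \<in> carrier H"
  shows "(ip_norm ip (x \<ominus>\<^bsub>H\<^esub> a \<odot>\<^bsub>H\<^esub> y))\<^sup>2
    = (ip_norm ip x)\<^sup>2 - 2 * Re (cnj a * ip x y) + (cmod a)\<^sup>2 * (ip_norm ip y)\<^sup>2"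
proof -
  have "ip (x \<ominus>\<^bsub>H\<^esub> a \<odot>\<^bsub>H\<^esub> y) (x \<ominus>\<^bsub>H\<^esub> a \<odot>\<^bsub>H\<^esub> y)
    = ip x x - cnj a * ip x y - a * (cnj (ip x y) - cnj a * ip y y)"
    using assms ip_commute[OF x y]
    by (simp add: ip_minus_left ip_minus_right ip_smult_left ip_smult_right smult_mem
        algebra_simps)
  also have "Re \<dots> = Re (ip x x) - 2 * Re (cnj a * ip x y) + (cmod a)\<^sup>2 * Re (ip y y)"
    by (subst (2) ip_self[OF y]) (simp add: cmod_power2, simp add: algebra_simps power2_eq_square)
  finally show ?thesis
    using assms by (simp add: ip_norm_sq smult_mem)
qed

lemma Cauchy_Schwarz:
  assumes x: "x \<in> carrier H" and y: "y \<in> carrier H"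
  shows "cmod (ip x y) \<le> ip_norm ip x * ip_norm ip y"
proof (cases "Re (ip y y) = 0")
  case True
  then have "y = \<zero>\<^bsub>H\<^esub>"
    using ip_self[OF y] ip_self_eq_0[OF y] by simp
  then have "ip x y = 0"
    using ip_commute[OF y x] ip_zero_left[OF x] by simp
  then show ?thesis
    using x y by (simp add: ip_norm_nonneg)
next
  case False
  define b where "b = Re (ip y y)"
  have b: "b > 0"
    using False ip_self_nonneg[OF y] by (simp add: b_def)
  \<comment> \<open>With this coefficient \<open>a y\<close> is the orthogonal projection of
    \<open>x\<close> onto the line spanned by \<open>y\<close>; the squared distance from
    \<open>x\<close> to it being nonnegative is the claim divided by \<open>b\<close>.\<close>
  define a where "a = ip x y / complex_of_real b"
  have "a \<in> K"
    using scalars ip_closed[OF x y] by (auto simp: a_def)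
  from ip_norm_sq_diff_smult[OF this x y]
  have "0 \<le> (ip_norm ip x)\<^sup>2 - 2 * Re (cnj a * ip x y) + (cmod a)\<^sup>2 * b"
    using y by (simp add: ip_norm_sq b_def) (metis zero_le_power2)
  moreover have "Re (cnj a * ip x y) = (cmod (ip x y))\<^sup>2 / b"
    unfolding a_def cmod_power2 by (simp add: power2_eq_square add_divide_distrib)
  moreover have "(cmod a)\<^sup>2 * b = (cmod (ip x y))\<^sup>2 / b"
    using b by (simp add: a_def norm_divide power2_eq_square)
  ultimately have "(cmod (ip x y))\<^sup>2 / b \<le> (ip_norm ip x)\<^sup>2"
    by simp
  then have "(cmod (ip x y))\<^sup>2 \<le> (ip_norm ip x * ip_norm ip y)\<^sup>2"
    using b y by (simp add: power_mult_distrib ip_norm_sq b_def divide_le_eq)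
  then show ?thesis
    using x y by (simp add: power2_le_iff_abs_le ip_norm_nonneg)
qed

section \<open>The two forms of the hypothesis and the last inequality\<close>

lemma Re_ip_smult_diff:
  assumes "\<gamma> \<in> K" "\<Gamma> \<in> K" and x: "x \<in> carrier H" and y: "y \<in> carrier H"
  shows "Re (ip (\<Gamma> \<odot>\<^bsub>H\<^esub> y \<ominus>\<^bsub>H\<^esub> x) (x \<ominus>\<^bsub>H\<^esub> \<gamma> \<odot>\<^bsub>H\<^esub> y))
    = Re ((cnj \<Gamma> + cnj \<gamma>) * ip x y) - Re (\<Gamma> * cnj \<gamma>) * (ip_norm ip y)\<^sup>2 - (ip_norm ip x)\<^sup>2"
proof -
  have "ip (\<Gamma> \<odot>\<^bsub>H\<^esub> y \<ominus>\<^bsub>H\<^esub> x) (x \<ominus>\<^bsub>H\<^esub> \<gamma> \<odot>\<^bsub>H\<^esub> y)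
    = \<Gamma> * cnj (ip x y) - \<Gamma> * cnj \<gamma> * ip y y - ip x x + cnj \<gamma> * ip x y"
    using assms ip_commute[OF x y]
    by (simp add: ip_minus_left ip_minus_right ip_smult_left ip_smult_right smult_mem
        algebra_simps)
  \<comment> \<open>Conjugating \<open>\<Gamma> * cnj (ip x y)\<close> keeps its real part, so the
    two cross terms merge. As \<open>\<Gamma> * cnj \<gamma>\<close> need not be real, its term
    splits only because \<open>ip y y\<close> is real.\<close>
  also have "Re \<dots>
    = Re ((cnj \<Gamma> + cnj \<gamma>) * ip x y) - Re (\<Gamma> * cnj \<gamma>) * Re (ip y y) - Re (ip x x)"
    by (subst ip_self[OF y]) (simp, simp add: algebra_simps)
  finally show ?thesis
    using x y by (simp add: ip_norm_sq)
qed

text \<open>With u = (\<Gamma> - \<gamma>)y/2 and v = x - (\<gamma> + \<Gamma>)y/2 the two arguments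
  are u - v and u + v, and the real part of their product is the difference of the squared norms.
  This makes the two hypotheses equivalent.\<close>

lemma Re_ip_smult_diff_eq_norms:
  assumes "\<gamma> \<in> K" "\<Gamma> \<in> K" and x: "x \<in> carrier H" and y: "y \<in> carrier H"
  shows "Re (ip (\<Gamma> \<odot>\<^bsub>H\<^esub> y \<ominus>\<^bsub>H\<^esub> x) (x \<ominus>\<^bsub>H\<^esub> \<gamma> \<odot>\<^bsub>H\<^esub> y))
    = (1 / 2 * cmod (\<Gamma> - \<gamma>) * ip_norm ip y)\<^sup>2
      - (ip_norm ip (x \<ominus>\<^bsub>H\<^esub> ((\<gamma> + \<Gamma>) / 2) \<odot>\<^bsub>H\<^esub> y))\<^sup>2"
proof -
  have mid: "(\<gamma> + \<Gamma>) / 2 \<in> K"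
    using scalars assms by auto
  show ?thesis
    unfolding ip_norm_sq_diff_smult[OF mid x y] Re_ip_smult_diff[OF assms]
    by (simp add: power_mult_distrib norm_divide power_divide cmod_power2)
       (simp add: power2_eq_square algebra_simps add_divide_distrib diff_divide_distrib)
qed

lemma norm_mult_minus_Re_ip_le:
  assumes mem: "\<gamma> \<in> K" "\<Gamma> \<in> K" "x \<in> carrier H" "y \<in> carrier H" and ne: "\<Gamma> \<noteq> - \<gamma>"
    and nonneg: "0 \<le> Re (ip (\<Gamma> \<odot>\<^bsub>H\<^esub> y \<ominus>\<^bsub>H\<^esub> x) (x \<ominus>\<^bsub>H\<^esub> \<gamma> \<odot>\<^bsub>H\<^esub> y))"
  shows "ip_norm ip x * ip_norm ip y
      - Re ((cnj \<Gamma> + cnj \<gamma>) / complex_of_real (cmod (\<Gamma> + \<gamma>)) * ip x y)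
    \<le> 1 / 4 * ((cmod (\<Gamma> - \<gamma>))\<^sup>2 / cmod (\<Gamma> + \<gamma>)) * (ip_norm ip y)\<^sup>2"
proof -
  define N where "N = cmod (\<Gamma> + \<gamma>)"
  define R where "R = Re ((cnj \<Gamma> + cnj \<gamma>) * ip x y)"
  define X where "X = ip_norm ip x"
  define Y where "Y = ip_norm ip y"
  have N: "N > 0"
    using ne by (simp add: N_def add_eq_0_iff2)
  \<comment> \<open>Polarization in the complex plane, which leaves only the two moduli of the final
    bound.\<close>
  have Re_mult: "Re (\<Gamma> * cnj \<gamma>) = (N\<^sup>2 - (cmod (\<Gamma> - \<gamma>))\<^sup>2) / 4"
    unfolding N_def cmod_power2 by (simp add: power2_eq_square algebra_simps)
  have "X\<^sup>2 + (N * Y / 2)\<^sup>2 \<le> R + (cmod (\<Gamma> - \<gamma>))\<^sup>2 * Y\<^sup>2 / 4"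
    using nonneg unfolding Re_ip_smult_diff[OF mem] Re_mult
    by (simp add: R_def X_def Y_def power_mult_distrib power_divide algebra_simps
        add_divide_distrib diff_divide_distrib)
  \<comment> \<open>AM-GM for \<open>X\<close> and \<open>N * Y / 2\<close>, as the nonnegativity of
    a square.\<close>
  moreover have "N * (X * Y) \<le> X\<^sup>2 + (N * Y / 2)\<^sup>2"
    using zero_le_power2[of "X - N * Y / 2"] by (simp add: power2_diff algebra_simps)
  ultimately have "N * (X * Y) - R \<le> (cmod (\<Gamma> - \<gamma>))\<^sup>2 * Y\<^sup>2 / 4"
    by simp
  then have "(N * (X * Y) - R) / N \<le> ((cmod (\<Gamma> - \<gamma>))\<^sup>2 * Y\<^sup>2 / 4) / N"
    using N by (intro divide_right_mono) auto
  moreover have "(N * (X * Y) - R) / N = X * Y - R / N"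
    using N by (simp add: diff_divide_distrib)
  moreover have "Re ((cnj \<Gamma> + cnj \<gamma>) / complex_of_real N * ip x y) = R / N"
    by (simp add: R_def flip: Re_divide_of_real)
  ultimately show ?thesis
    unfolding N_def[symmetric] X_def[symmetric] Y_def[symmetric] by (simp only: mult_ac) simp
qed

end

section \<open>The plane as extremal example\<close>

definition plane :: "(complex, complex) module" where
  "plane = \<lparr>carrier = UNIV, monoid.mult = (*), one = 1, ring.zero = 0, add = (+), smult = (*)\<rparr>"

text \<open>One carrier serves both fields: over \<real> this is the dot product of the Euclidean
  plane, embedded in \<open>complex\<close>, and over \<open>UNIV\<close> the Hermitian product of
  the one-dimensional complex space.\<close>

definition plane_ip :: "complex set \<Rightarrow> complex \<Rightarrow> complex \<Rightarrow> complex" where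
  "plane_ip K x y = (if K = \<real> then complex_of_real (Re (x * cnj y)) else x * cnj y)"

lemma plane_simps [simp]:
  "carrier plane = UNIV" "x \<oplus>\<^bsub>plane\<^esub> y = x + y" "\<zero>\<^bsub>plane\<^esub> = 0" "a \<odot>\<^bsub>plane\<^esub> x = a * x"
  by (simp_all add: plane_def)

lemma abelian_group_plane: "abelian_group plane"
proof (rule abelian_groupI)
  fix x
  show "\<exists>y\<in>carrier plane. y \<oplus>\<^bsub>plane\<^esub> x = \<zero>\<^bsub>plane\<^esub>"
    by (intro bexI[of _ "- x"]) auto
qed (auto simp: algebra_simps)

lemma plane_minus [simp]: "x \<ominus>\<^bsub>plane\<^esub> y = x - y"
proof -
  interpret abelian_group plane
    by (rule abelian_group_plane)
  \<comment> \<open>Subtraction is not a field of the record but derived from the group inverse,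
    which has to be identified first.\<close>
  have "\<ominus>\<^bsub>plane\<^esub> y = - y"
    using r_neg[of y] by (simp add: add_eq_0_iff)
  then show ?thesis
    by (simp add: minus_eq)
qed

lemma cring_scalar_field:
  assumes "K = \<real> \<or> K = UNIV"
  shows "cring (scalar_field K)"
proof (rule cringI)
  show "abelian_group (scalar_field K)"
  proof (rule abelian_groupI)
    fix x assume "x \<in> carrier (scalar_field K)"
    then show "\<exists>y\<in>carrier (scalar_field K).
        y \<oplus>\<^bsub>scalar_field K\<^esub> x = \<zero>\<^bsub>scalar_field K\<^esub>"
      using assms by (intro bexI[of _ "- x"]) (auto simp: scalar_field_def)
  qed (use assms in \<open>auto simp: scalar_field_def algebra_simps\<close>)
  show "comm_monoid (scalar_field K)"
    by (rule comm_monoidI) (use assms in \<open>auto simp: scalar_field_def algebra_simps\<close>)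
qed (use assms in \<open>auto simp: scalar_field_def algebra_simps\<close>)

lemma inner_product_space_plane:
  assumes K: "K = \<real> \<or> K = UNIV"
  shows "inner_product_space K plane (plane_ip K)"
proof -
  have "module (scalar_field K) plane"
    by (intro module.intro cring_scalar_field[OF K] abelian_group_plane module_axioms.intro)
       (auto simp: scalar_field_def algebra_simps)
  moreover have "inner_product_space_axioms K plane (plane_ip K)"
  proof (unfold_locales)
    show "plane_ip K x y \<in> K" for x y
      using K by (auto simp: plane_ip_def)
    show "plane_ip K (a \<odot>\<^bsub>plane\<^esub> x) y = a * plane_ip K x y" if "a \<in> K" for a x y
      using K that by (auto simp: plane_ip_def elim!: Reals_cases simp: complex_eq_iff algebra_simps)
    \<comment> \<open>Over either field the real part of \<open>x * cnj x\<close> is the sum of the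
      squared coordinates.\<close>
    show "x = \<zero>\<^bsub>plane\<^esub>" if "plane_ip K x x = 0" for x
      using that
      by (auto simp: plane_ip_def complex_eq_iff sum_power2_eq_zero_iff simp flip: power2_eq_square
          split: if_splits)
  qed (use K in \<open>auto simp: plane_ip_def algebra_simps\<close>)
  ultimately show ?thesis
    by (rule inner_product_space.intro)
qed

lemma quarter_le_if_plane_bound:
  assumes K: "K = \<real> \<or> K = UNIV"
    and bound: "\<forall>x \<in> carrier plane. \<forall>y \<in> carrier plane. \<forall>\<gamma> \<in> K. \<forall>\<Gamma> \<in> K.
      \<Gamma> \<noteq> \<gamma> \<and> \<Gamma> \<noteq> - \<gamma>
      \<and> 0 \<le> Re (plane_ip K (\<Gamma> \<odot>\<^bsub>plane\<^esub> y \<ominus>\<^bsub>plane\<^esub> x) (x \<ominus>\<^bsub>plane\<^esub> \<gamma> \<odot>\<^bsub>plane\<^esub> y)) \<longrightarrow>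
      ip_norm (plane_ip K) x * ip_norm (plane_ip K) y
          - Re ((cnj \<Gamma> + cnj \<gamma>) / complex_of_real (cmod (\<Gamma> + \<gamma>)) * plane_ip K x y)
        \<le> c * ((cmod (\<Gamma> - \<gamma>))\<^sup>2 / cmod (\<Gamma> + \<gamma>)) * (ip_norm (plane_ip K) y)\<^sup>2"
  shows "1 / 4 \<le> c"
proof -
  \<comment> \<open>\<open>7/25 + 24/25 \<i>\<close> is \<open>(4/5 + 3/5 \<i>)\<^sup>2\<close>, hence at the rational distance \<open>2 \<cdot> 3/5\<close> from \<open>1\<close>.\<close>
  define x where "x = Complex (7 / 25) (24 / 25)"
  \<comment> \<open>These are 1 + 6/5 and 1 - 6/5: their midpoint is 1 and half their difference is
    the distance 6/5 from \<open>x\<close> to 1.\<close>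
  define \<Gamma> \<gamma> :: complex where "\<Gamma> = complex_of_real (11 / 5)" and "\<gamma> = complex_of_real (- 1 / 5)"
  have mem: "\<Gamma> \<in> K" "\<gamma> \<in> K"
    using K by (auto simp: \<Gamma>_def \<gamma>_def simp del: of_real_divide of_real_minus)
  have sum: "\<Gamma> + \<gamma> = 2" and diff: "\<Gamma> - \<gamma> = complex_of_real (12 / 5)"
    by (simp_all add: \<Gamma>_def \<gamma>_def complex_eq_iff)
  have cnj_sum: "cnj \<Gamma> + cnj \<gamma> = 2"
    by (simp add: \<Gamma>_def \<gamma>_def complex_eq_iff)
  have cmod_diff: "cmod (\<Gamma> - \<gamma>) = 12 / 5"
    unfolding diff norm_of_real by simp
  have norms: "ip_norm (plane_ip K) x = 1" "ip_norm (plane_ip K) 1 = 1"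
    by (simp_all add: ip_norm_def plane_ip_def x_def)
  have ip: "Re (plane_ip K x 1) = 7 / 25"
    by (simp add: plane_ip_def x_def)
  have ne: "\<Gamma> \<noteq> \<gamma>" "\<Gamma> \<noteq> - \<gamma>"
    by (simp_all add: \<Gamma>_def \<gamma>_def complex_eq_iff)
  \<comment> \<open>The value is exactly 0, since \<open>x\<close> lies on the boundary of the
    admissible disc.\<close>
  have nonneg: "0 \<le> Re (plane_ip K (\<Gamma> \<odot>\<^bsub>plane\<^esub> 1 \<ominus>\<^bsub>plane\<^esub> x) (x \<ominus>\<^bsub>plane\<^esub> \<gamma> \<odot>\<^bsub>plane\<^esub> 1))"
    by (simp add: plane_ip_def x_def \<Gamma>_def \<gamma>_def)
  have "ip_norm (plane_ip K) x * ip_norm (plane_ip K) 1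
      - Re ((cnj \<Gamma> + cnj \<gamma>) / complex_of_real (cmod (\<Gamma> + \<gamma>)) * plane_ip K x 1)
    \<le> c * ((cmod (\<Gamma> - \<gamma>))\<^sup>2 / cmod (\<Gamma> + \<gamma>)) * (ip_norm (plane_ip K) 1)\<^sup>2"
    using bound mem ne nonneg by simp
  \<comment> \<open>The bound now reads 18/25 \<le> c * 72/25.\<close>
  then show ?thesis
    by (simp add: sum cnj_sum cmod_diff norms ip power_divide)
qed

theorem theorem2:
  fixes K :: "complex set"
    and H :: "(complex, 'v) module"
    and ip :: "'v \<Rightarrow> 'v \<Rightarrow> complex"
  assumes K: "K = \<real> \<or> K = UNIV"
  shows
    "(inner_product_space K H ip \<longrightarrow>
       (\<forall>x \<in> carrier H. \<forall>y \<in> carrier H. \<forall>\<gamma> \<in> K. \<forall>\<Gamma> \<in> K. \<Gamma> \<noteq> \<gamma> \<and> \<Gamma> \<noteq> - \<gamma> \<longrightarrow>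
          (0 \<le> Re (ip (\<Gamma> \<odot>\<^bsub>H\<^esub> y \<ominus>\<^bsub>H\<^esub> x) (x \<ominus>\<^bsub>H\<^esub> \<gamma> \<odot>\<^bsub>H\<^esub> y)) \<longleftrightarrow>
           ip_norm ip (x \<ominus>\<^bsub>H\<^esub> ((\<gamma> + \<Gamma>) / 2) \<odot>\<^bsub>H\<^esub> y) \<le> 1 / 2 * cmod (\<Gamma> - \<gamma>) * ip_norm ip y)
          \<and>
          (0 \<le> Re (ip (\<Gamma> \<odot>\<^bsub>H\<^esub> y \<ominus>\<^bsub>H\<^esub> x) (x \<ominus>\<^bsub>H\<^esub> \<gamma> \<odot>\<^bsub>H\<^esub> y)) \<or>
           ip_norm ip (x \<ominus>\<^bsub>H\<^esub> ((\<gamma> + \<Gamma>) / 2) \<odot>\<^bsub>H\<^esub> y) \<le> 1 / 2 * cmod (\<Gamma> - \<gamma>) * ip_norm ip y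
           \<longrightarrow>
           0 \<le> ip_norm ip x * ip_norm ip y - cmod (ip x y)
           \<and> ip_norm ip x * ip_norm ip y - cmod (ip x y)
               \<le> ip_norm ip x * ip_norm ip y
                  - \<bar>Re ((cnj \<Gamma> + cnj \<gamma>) / complex_of_real (cmod (\<Gamma> + \<gamma>)) * ip x y)\<bar>
           \<and> ip_norm ip x * ip_norm ip y
                  - \<bar>Re ((cnj \<Gamma> + cnj \<gamma>) / complex_of_real (cmod (\<Gamma> + \<gamma>)) * ip x y)\<bar>
               \<le> ip_norm ip x * ip_norm ip y
                  - Re ((cnj \<Gamma> + cnj \<gamma>) / complex_of_real (cmod (\<Gamma> + \<gamma>)) * ip x y)
           \<and> ip_norm ip x * ip_norm ip y
                  - Re ((cnj \<Gamma> + cnj \<gamma>) / complex_of_real (cmod (\<Gamma> + \<gamma>)) * ip x y)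
               \<le> 1 / 4 * ((cmod (\<Gamma> - \<gamma>))\<^sup>2 / cmod (\<Gamma> + \<gamma>)) * (ip_norm ip y)\<^sup>2)))
     \<and>
     \<not> (\<exists>c::real. c < 1 / 4 \<and>
          (\<forall>(H' :: (complex, complex) module) ip'. inner_product_space K H' ip' \<longrightarrow>
             (\<forall>x \<in> carrier H'. \<forall>y \<in> carrier H'. \<forall>\<gamma> \<in> K. \<forall>\<Gamma> \<in> K.
                \<Gamma> \<noteq> \<gamma> \<and> \<Gamma> \<noteq> - \<gamma>
                \<and> 0 \<le> Re (ip' (\<Gamma> \<odot>\<^bsub>H'\<^esub> y \<ominus>\<^bsub>H'\<^esub> x) (x \<ominus>\<^bsub>H'\<^esub> \<gamma> \<odot>\<^bsub>H'\<^esub> y)) \<longrightarrow>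
                ip_norm ip' x * ip_norm ip' y
                    - Re ((cnj \<Gamma> + cnj \<gamma>) / complex_of_real (cmod (\<Gamma> + \<gamma>)) * ip' x y)
                  \<le> c * ((cmod (\<Gamma> - \<gamma>))\<^sup>2 / cmod (\<Gamma> + \<gamma>)) * (ip_norm ip' y)\<^sup>2)))"
proof (intro conjI impI ballI)
  fix x y \<gamma> \<Gamma>
  assume "inner_product_space K H ip"
  then interpret inner_product_space K H ip .
  assume mem: "x \<in> carrier H" "y \<in> carrier H" "\<gamma> \<in> K" "\<Gamma> \<in> K" and "\<Gamma> \<noteq> \<gamma> \<and> \<Gamma> \<noteq> - \<gamma>"
  then have ne: "\<Gamma> \<noteq> - \<gamma>"
    by simp
  let ?Re = "Re (ip (\<Gamma> \<odot>\<^bsub>H\<^esub> y \<ominus>\<^bsub>H\<^esub> x) (x \<ominus>\<^bsub>H\<^esub> \<gamma> \<odot>\<^bsub>H\<^esub> y))"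
  let ?d = "ip_norm ip (x \<ominus>\<^bsub>H\<^esub> ((\<gamma> + \<Gamma>) / 2) \<odot>\<^bsub>H\<^esub> y)"
  let ?r = "1 / 2 * cmod (\<Gamma> - \<gamma>) * ip_norm ip y"
  have "(\<gamma> + \<Gamma>) / 2 \<in> K"
    using K mem by auto
  then have "0 \<le> ?d" "0 \<le> ?r"
    using mem by (auto intro!: ip_norm_nonneg mult_nonneg_nonneg smult_mem)
  \<comment> \<open>\<open>?Re\<close> is the square of \<open>?r\<close> minus the square of
    \<open>?d\<close>, and both numbers are nonnegative.\<close>
  then show equiv: "0 \<le> ?Re \<longleftrightarrow> ?d \<le> ?r"
    unfolding Re_ip_smult_diff_eq_norms[OF mem(3,4,1,2)]
    by (metis diff_ge_0_iff_ge power2_le_imp_le power_mono)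
  let ?u = "(cnj \<Gamma> + cnj \<gamma>) / complex_of_real (cmod (\<Gamma> + \<gamma>))"
  assume "0 \<le> ?Re \<or> ?d \<le> ?r"
  then have "0 \<le> ?Re"
    using equiv by blast
  then show "ip_norm ip x * ip_norm ip y - Re (?u * ip x y)
      \<le> 1 / 4 * ((cmod (\<Gamma> - \<gamma>))\<^sup>2 / cmod (\<Gamma> + \<gamma>)) * (ip_norm ip y)\<^sup>2"
    by (rule norm_mult_minus_Re_ip_le[OF mem(3,4,1,2) ne])
  show "0 \<le> ip_norm ip x * ip_norm ip y - cmod (ip x y)"
    using Cauchy_Schwarz[OF mem(1,2)] by simp
  have "cmod (cnj \<Gamma> + cnj \<gamma>) = cmod (\<Gamma> + \<gamma>)"
    by (metis complex_cnj_add complex_mod_cnj)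
  \<comment> \<open>Multiplication by \<open>?u\<close> is a rotation, so the real part of the
    rotated product is still bounded by \<open>cmod (ip x y)\<close>.\<close>
  then have "cmod ?u = 1"
    using ne by (simp add: norm_divide add_eq_0_iff2)
  then have "\<bar>Re (?u * ip x y)\<bar> \<le> cmod (ip x y)"
    using abs_Re_le_cmod[of "?u * ip x y"] by (simp only: norm_mult mult_1)
  then show "ip_norm ip x * ip_norm ip y - cmod (ip x y)
      \<le> ip_norm ip x * ip_norm ip y - \<bar>Re (?u * ip x y)\<bar>"
    by simp
  show "ip_norm ip x * ip_norm ip y - \<bar>Re (?u * ip x y)\<bar>
      \<le> ip_norm ip x * ip_norm ip y - Re (?u * ip x y)"
    by (rule diff_left_mono) (rule abs_ge_self)
next
  show "\<not> (\<exists>c::real. c < 1 / 4 \<and>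
          (\<forall>(H' :: (complex, complex) module) ip'. inner_product_space K H' ip' \<longrightarrow>
             (\<forall>x \<in> carrier H'. \<forall>y \<in> carrier H'. \<forall>\<gamma> \<in> K. \<forall>\<Gamma> \<in> K.
                \<Gamma> \<noteq> \<gamma> \<and> \<Gamma> \<noteq> - \<gamma>
                \<and> 0 \<le> Re (ip' (\<Gamma> \<odot>\<^bsub>H'\<^esub> y \<ominus>\<^bsub>H'\<^esub> x) (x \<ominus>\<^bsub>H'\<^esub> \<gamma> \<odot>\<^bsub>H'\<^esub> y)) \<longrightarrow>
                ip_norm ip' x * ip_norm ip' y
                    - Re ((cnj \<Gamma> + cnj \<gamma>) / complex_of_real (cmod (\<Gamma> + \<gamma>)) * ip' x y)
                  \<le> c * ((cmod (\<Gamma> - \<gamma>))\<^sup>2 / cmod (\<Gamma> + \<gamma>)) * (ip_norm ip' y)\<^sup>2)))"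
    \<comment> \<open>The plane is among the spaces quantified over, so a smaller constant would
      have to be at least \<open>1 / 4\<close>.\<close>
    using quarter_le_if_plane_bound[OF K] inner_product_space_plane[OF K]
    by (meson not_less)
qed

end
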